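(* Let $n\ge 1$ and let $$q(t_1,\dots,t_n)=\sum_{k_1,\dots,k_n\ge 0} a_{k_1,\dots,k_n}\,t_1^{k_1}\cdots t_n^{k_n},\qquad a_{0,\dots,0}=0,$$ be a polynomial in $n$ real variables with complex coefficients. Then there exists a random vector $(X_1,\dots,X_n)$ with characteristic function $\varphi(t_1,\dots,t_n)=\mathbb{E}\,e^{i(t_1X_1+\dots+t_nX_n)}$, whose components $X_1,\dots,X_n$ have characteristic functions $\varphi_1,\dots,\varphi_n$ respectively, such that $$\varphi(t_1,\dots,t_n)=\varphi_1(t_1)\cdots\varphi_n(t_n)\exp\big(q(t_1,\dots,t_n)\big)\quad\text{for all } t_1,\dots,t_n\in\mathbb{R},$$ if and only if the following two conditions hold: (i) $q$ contains no monomials depending on only one variable, i.e. $a_{k_1,\dots,k_n}=0$ whenever exactly one of $k_1,\dots,k_n$ is nonzero; (ii) for every multi-index $(k_1,\dots,k_n)$, the coefficient $a_{k_1,\dots,k_n}$ is real if $k_1+\dots+k_n$ is even, and purely imaginary (i.e. lies in $i\mathbb{R}$) if $k_1+\dots+k_n$ is odd.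
   Context: The characteristic function of a random vector $(X_1,\dots,X_n)$ is $\varphi(t_1,\dots,t_n)=\mathbb{E}\exp(i(t_1X_1+\dots+t_nX_n))$, and that of a random variable $X_j$ is $\varphi_j(t)=\mathbb{E}\exp(itX_j)$. (Random variables satisfying the displayed identity for some polynomial $q$ with $q(0,\dots,0)=0$ are called $Q$-independent.) *)

theory Defs
  imports "HOL-Probability.Probability"
begin

text \<open>A polynomial in the variables t_j (j :: 'n) with complex coefficients is given by its
coefficient function a on multi-indices k :: 'n \<Rightarrow> nat, with finite support.\<close>

definition mpoly_eval :: "(('n::finite \<Rightarrow> nat) \<Rightarrow> complex) \<Rightarrow> real ^ 'n \<Rightarrow> complex" where
  "mpoly_eval a t = (\<Sum>k\<in>{k. a k \<noteq> 0}. a k * (\<Prod>j\<in>UNIV. complex_of_real ((t $ j) ^ k j)))"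

definition char_fun_vec :: "(real ^ 'n::finite) measure \<Rightarrow> real ^ 'n \<Rightarrow> complex" where
  "char_fun_vec M t = (LINT x|M. exp (\<i> * complex_of_real (\<Sum>j\<in>UNIV. t $ j * x $ j)))"

definition char_fun_comp :: "(real ^ 'n::finite) measure \<Rightarrow> 'n \<Rightarrow> real \<Rightarrow> complex" where
  "char_fun_comp M j s = (LINT x|M. exp (\<i> * complex_of_real (s * x $ j)))"

end

theory Submission
  imports Defs "HOL-Real_Asymp.Real_Asymp"
begin

text \<open>
  Necessity: near the origin no \<open>\<phi>\<^sub>j\<close> vanishes, so restricting the identity to a coordinate axis, or
  conjugating it, gives \<open>exp Q = 1\<close> for a polynomial \<open>Q\<close> with \<open>Q 0 = 0\<close>; by continuity \<open>Q = 0\<close> near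
  the origin, hence all its coefficients vanish.

  Sufficiency: the density \<open>p\<close> proportional to \<open>(cosh 1 - cos x) / (1 + x\<^sup>2)\<close> has no real zeros and is
  band-limited, and its derivatives satisfy \<open>\<bar>p\<^sup>(\<^sup>k\<^sup>)\<bar> \<le> C 4\<^sup>k p\<close>; rescaling replaces 4 by any \<open>B > 0\<close> with the
  same \<open>C\<close>. Multiplying the characteristic function of the product density by a monomial in the
  \<open>- \<i> t\<^sub>j\<close> amounts to differentiating the density. Condition (ii) makes \<open>q\<close> a real polynomial in
  the \<open>- \<i> t\<^sub>j\<close> without constant term, so expanding \<open>exp q\<close> turns the product density \<open>\<Prod>p\<close> into a real
  density \<open>F \<Prod>p\<close> with \<open>\<bar>F - 1\<bar> \<le> 1\<close> once \<open>B\<close> is small. By (i) its marginals are still \<open>p\<close>.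
\<close>

section \<open>Vanishing of coefficients\<close>

abbreviation (input) monom_at :: "('n::finite \<Rightarrow> nat) \<Rightarrow> real ^ 'n \<Rightarrow> complex" where
  "monom_at k t \<equiv> (\<Prod>j\<in>UNIV. complex_of_real ((t $ j) ^ k j))"

text \<open>Artin's argument for the independence of characters: monomials are multiplicative, and balls
  around 0 are invariant under componentwise multiplication by vectors with entries in \<open>[-1, 1]\<close>.\<close>

lemma monomials_independent:
  fixes b :: "('n::finite \<Rightarrow> nat) \<Rightarrow> complex"
  assumes "finite S" "\<delta> > 0"
    and "\<And>t. norm t < \<delta> \<Longrightarrow> (\<Sum>k\<in>S. b k * monom_at k t) = 0"
    and "k \<in> S"
  shows "b k = 0"
  using assms(1,3,4)
proof (induction S arbitrary: b k rule: finite_induct)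
  case (insert l S)
  have others: "b k = 0" if k: "k \<in> S" for k
  proof -
    from insert.hyps k obtain i where i: "k i \<noteq> l i" by (metis ext)
    \<comment> \<open>\<open>u\<close> halves only a coordinate \<open>i\<close> in which the
      exponents of \<open>k\<close> and \<open>l\<close> differ, so the values
      \<open>(1/2) ^ k i\<close> and \<open>(1/2) ^ l i\<close> of the two monomials at
      \<open>u\<close> are distinct.\<close>
    define u :: "real ^ 'n" where "u = (\<chi> j. if j = i then 1/2 else 1)"
    have u: "monom_at m u = (1/2) ^ m i" for m :: "'n \<Rightarrow> nat"
    proof -
      have "monom_at m u = (\<Prod>j\<in>UNIV. if j = i then (1/2) ^ m i else 1)"
        by (intro prod.cong) (auto simp: u_def power_divide)
      then show ?thesis by simp
    qed
    \<comment> \<open>Subtracting \<open>monom_at l u\<close> times the relation at \<open>t\<close>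
      from the relation at the componentwise product of \<open>u\<close> and \<open>t\<close>
      cancels the term of \<open>l\<close>. The induction hypothesis applies to the shorter relation
      that is left.\<close>
    have "b k * (monom_at k u - monom_at l u) = 0"
    proof (rule insert.IH[of "\<lambda>m. b m * (monom_at m u - monom_at l u)", OF _ k])
      fix t :: "real ^ 'n" assume t: "norm t < \<delta>"
      define ut where "ut = (\<chi> j. u $ j * t $ j)"
      have "norm ut \<le> norm t"
        by (rule norm_le_componentwise_cart) (auto simp: ut_def u_def abs_mult)
      then have "norm ut < \<delta>" using t by simp
      moreover have "monom_at m ut = monom_at m u * monom_at m t" for m :: "'n \<Rightarrow> nat"
        by (simp add: ut_def power_mult_distrib prod.distrib)
      ultimately have 1: "(\<Sum>m\<in>insert l S. b m * (monom_at m u * monom_at m t)) = 0"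
        using insert.prems(1)[of ut] by simp
      have "0 = (\<Sum>m\<in>insert l S. b m * (monom_at m u * monom_at m t))
              - monom_at l u * (\<Sum>m\<in>insert l S. b m * monom_at m t)"
        using 1 insert.prems(1)[OF t] by simp
      also have "\<dots> = (\<Sum>m\<in>insert l S. b m * (monom_at m u - monom_at l u) * monom_at m t)"
        unfolding sum_distrib_left sum_subtractf[symmetric] by (intro sum.cong refl) (simp add: algebra_simps)
      also have "\<dots> = (\<Sum>m\<in>S. b m * (monom_at m u - monom_at l u) * monom_at m t)"
        using insert.hyps by simp
      finally show "(\<Sum>m\<in>S. b m * (monom_at m u - monom_at l u) * monom_at m t) = 0" by simp
    qed
    moreover have "monom_at k u \<noteq> monom_at l u"
    proof
      assume "monom_at k u = monom_at l u"
      then have "((1/2)::complex) ^ k i = (1/2) ^ l i" unfolding u .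
      then have "complex_of_real ((1/2) ^ k i) = complex_of_real ((1/2) ^ l i)" by simp
      then have "(1/2 :: real) ^ k i = (1/2) ^ l i" unfolding of_real_eq_iff .
      then show False using i by (simp add: power_divide)
    qed
    ultimately show ?thesis by simp
  qed
  \<comment> \<open>Only the term of \<open>l\<close> survives. It is evaluated at a small positive
    multiple of the all-ones vector, where no monomial vanishes.\<close>
  have "b l = 0"
  proof -
    have "((\<lambda>s. norm (s *\<^sub>R (\<chi> j. 1) :: real ^ 'n)) \<longlongrightarrow> norm (0 *\<^sub>R (\<chi> j. 1) :: real ^ 'n)) (at_right 0)"
      by (intro tendsto_intros)
    then have "eventually (\<lambda>s. norm (s *\<^sub>R (\<chi> j. 1) :: real ^ 'n) < \<delta>) (at_right 0)"
      by (rule order_tendstoD) (use \<open>\<delta> > 0\<close> in simp)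
    moreover have "eventually (\<lambda>s::real. s > 0) (at_right 0)"
      by (rule eventually_at_right_less)
    ultimately have "eventually (\<lambda>s. s > 0 \<and> norm (s *\<^sub>R (\<chi> j. 1) :: real ^ 'n) < \<delta>) (at_right 0)"
      by eventually_elim simp
    then obtain s :: real where s: "s > 0" "norm (s *\<^sub>R (\<chi> j. 1) :: real ^ 'n) < \<delta>"
      using eventually_happens' trivial_limit_at_right_real by blast
    have "b l * monom_at l (s *\<^sub>R (\<chi> j. 1)) = 0"
      using insert.prems(1)[OF s(2)] insert.hyps by (simp add: others)
    then show ?thesis using s(1) by simp
  qed
  with others insert.prems(2) show ?case by auto
qed simp

text \<open>The solutions of \<open>exp w = 1\<close> are the integer multiples of
  \<open>2 * pi * \<i>\<close>, and 0 is the only one of modulus below \<open>2 * pi\<close>.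
  Continuity keeps \<open>Q t\<close> below that modulus near \<open>z\<close>.\<close>

lemma exp_eq_1_imp_locally_zero:
  fixes Q :: "'a::metric_space \<Rightarrow> complex"
  assumes "isCont Q z" "Q z = 0" "eventually (\<lambda>t. exp (Q t) = 1) (nhds z)"
  shows "eventually (\<lambda>t. Q t = 0) (nhds z)"
proof -
  have "(Q \<longlongrightarrow> 0) (nhds z)"
    using assms(1,2) by (simp add: continuous_at tendsto_nhds_iff)
  then have "eventually (\<lambda>t. norm (Q t) < 2 * pi) (nhds z)"
    using tendstoD[of Q 0 "nhds z" "2 * pi"] by simp
  with assms(3) show ?thesis
  proof eventually_elim
    case (elim t)
    then obtain n :: int where n: "Re (Q t) = 0" "Im (Q t) = of_int (2 * n) * pi"
      by (auto simp: exp_eq_1)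
    have "\<bar>Im (Q t)\<bar> < 2 * pi" using abs_Im_le_cmod[of "Q t"] elim by linarith
    then have "\<bar>of_int n :: real\<bar> < 1" using n by (simp add: abs_mult)
    then have "n = 0" by linarith
    with n show ?case by (simp add: complex_eq_iff)
  qed
qed

section \<open>Characteristic functions near the origin and on the axes\<close>

lemma isCont_mpoly_eval: "isCont (mpoly_eval a) t"
  unfolding mpoly_eval_def[abs_def] by (intro continuous_intros)

lemma char_fun_comp_eq_char:
  assumes "sets M = sets borel"
  shows "char_fun_comp M j = char (distr M borel (\<lambda>x. x $ j))"
proof -
  have [measurable]: "(\<lambda>x. x $ j) \<in> M \<rightarrow>\<^sub>M borel"
    using assms by (simp cong: measurable_cong_sets)
  show ?thesis
    by (auto simp: fun_eq_iff char_fun_comp_def char_def integral_distr)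
qed

text \<open>Each component function is continuous with value 1 at 0, and there are only finitely
  many components. This permits cancelling them near the origin.\<close>

lemma char_fun_comp_nonzero:
  fixes M :: "(real ^ 'n::finite) measure"
  assumes "prob_space M" "sets M = sets borel"
  shows "eventually (\<lambda>t. \<forall>j. char_fun_comp M j (t $ j) \<noteq> 0) (nhds 0)"
proof -
  have "eventually (\<lambda>t. char_fun_comp M j (t $ j) \<noteq> 0) (nhds 0)" for j
  proof -
    have m: "(\<lambda>x. x $ j) \<in> M \<rightarrow>\<^sub>M borel"
      using assms by (simp cong: measurable_cong_sets)
    interpret real_distribution "distr M borel (\<lambda>x. x $ j)"
      using prob_space.real_distribution_distr[OF assms(1) m] .
    have "isCont (\<lambda>t :: real ^ 'n. char_fun_comp M j (t $ j)) 0"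
      unfolding char_fun_comp_eq_char[OF assms(2)]
      by (intro continuous_within_compose3[OF isCont_char]) (auto intro: continuous_intros)
    then have "((\<lambda>t :: real ^ 'n. char_fun_comp M j (t $ j)) \<longlongrightarrow> char_fun_comp M j 0) (nhds 0)"
      by (simp add: continuous_at tendsto_nhds_iff)
    moreover have "char_fun_comp M j 0 = 1"
      unfolding char_fun_comp_eq_char[OF assms(2)] by (rule char_zero)
    ultimately show ?thesis
      using tendsto_imp_eventually_ne[of _ 1 "nhds 0" 0] by fastforce
  qed
  then show ?thesis by (intro eventually_all_finite)
qed

lemma cnj_char_fun:
  "cnj (char_fun_vec M t) = char_fun_vec M (- t)" "cnj (char_fun_comp M j s) = char_fun_comp M j (- s)"
proof -
  show "cnj (char_fun_vec M t) = char_fun_vec M (- t)"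
    unfolding char_fun_vec_def Bochner_Integration.integral_cnj[symmetric]
    by (intro Bochner_Integration.integral_cong refl) (simp add: exp_cnj sum_negf)
  show "cnj (char_fun_comp M j s) = char_fun_comp M j (- s)"
    unfolding char_fun_comp_def Bochner_Integration.integral_cnj[symmetric]
    by (intro Bochner_Integration.integral_cong refl) (simp add: exp_cnj)
qed

lemma mpoly_eval_zero:
  assumes "a (\<lambda>_. 0) = 0"
  shows "mpoly_eval a 0 = 0"
  unfolding mpoly_eval_def
proof (intro sum.neutral ballI)
  fix k assume "k \<in> {k. a k \<noteq> 0}"
  with assms have "k \<noteq> (\<lambda>_. 0)" by auto
  then obtain j where "k j \<noteq> 0" by auto
  then have "(\<Prod>j\<in>UNIV. complex_of_real ((0 $ j) ^ k j)) = 0" by (intro prod_zero) (auto intro!: bexI[of _ j])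
  then show "a k * (\<Prod>j\<in>UNIV. complex_of_real ((0 $ j) ^ k j)) = 0" by simp
qed

lemma char_fun_axis:
  fixes M :: "(real ^ 'n::finite) measure"
  shows "char_fun_vec M (axis j s) = char_fun_comp M j s"
proof -
  have "(\<Sum>i\<in>UNIV. axis j s $ i * x $ i) = s * x $ j" for x :: "real ^ 'n"
  proof -
    have "(\<Sum>i\<in>UNIV. axis j s $ i * x $ i) = (\<Sum>i\<in>UNIV. if i = j then s * x $ j else 0)"
      by (intro sum.cong) (auto simp: axis_def)
    then show ?thesis by simp
  qed
  then show ?thesis by (simp add: char_fun_vec_def char_fun_comp_def)
qed

lemma char_fun_comp_0: "prob_space M \<Longrightarrow> char_fun_comp M j 0 = 1"
  by (simp add: char_fun_comp_def prob_space.prob_space)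

section \<open>Necessity of the two conditions\<close>

text \<open>The second conclusion is condition (ii) as a single equation: conjugation fixes exactly
  the real numbers and negates exactly the purely imaginary ones.\<close>

lemma Q_independence_necessary:
  fixes a :: "('n::finite \<Rightarrow> nat) \<Rightarrow> complex"
  assumes fin: "finite {k. a k \<noteq> 0}" and a0: "a (\<lambda>_. 0) = 0"
    and M: "prob_space M" "sets M = sets borel"
    and eq: "\<And>t. char_fun_vec M t = (\<Prod>j\<in>UNIV. char_fun_comp M j (t $ j)) * exp (mpoly_eval a t)"
  shows "card {j. k j \<noteq> 0} = 1 \<Longrightarrow> a k = 0" "cnj (a k) = (-1) ^ (\<Sum>j\<in>UNIV. k j) * a k"
proof -
  note nz = char_fun_comp_nonzero[OF M]
  define S where "S = {k. a k \<noteq> 0}"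
  have q_eq: "mpoly_eval a t = (\<Sum>k\<in>S. a k * monom_at k t)" for t
    by (simp add: mpoly_eval_def S_def)
  show "a k = 0" if card: "card {j. k j \<noteq> 0} = 1"
  proof (rule ccontr)
    assume "a k \<noteq> 0"
    from card obtain j where j: "{j. k j \<noteq> 0} = {j}" by (auto simp: card_1_singleton_iff)
    \<comment> \<open>The restriction of the polynomial to the axis \<open>j\<close> is regarded as
      a function of all variables, so that \<open>monomials_independent\<close> applies to
      it.\<close>
    define Q where "Q = (\<lambda>t :: real ^ 'n. mpoly_eval a (axis j (t $ j)))"
    have cont_axis: "isCont (\<lambda>t :: real ^ 'n. axis j (t $ j)) x" for x
      unfolding axis_def by (auto intro!: continuous_intros simp: isCont_def vec_eq_iff intro!: vec_tendstoI tendsto_intros)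
    have "eventually (\<lambda>t. Q t = 0) (nhds 0)"
    proof (rule exp_eq_1_imp_locally_zero)
      show "isCont Q 0" unfolding Q_def
        by (rule continuous_within_compose3[OF isCont_mpoly_eval cont_axis])
      show "Q 0 = 0" proof -
        have "axis j 0 = (0 :: real ^ 'n)" by (simp add: vec_eq_iff axis_def)
        then show ?thesis using mpoly_eval_zero[of a] a0 by (simp only: Q_def zero_index)
      qed
      show "eventually (\<lambda>t. exp (Q t) = 1) (nhds 0)"
        using nz
      proof eventually_elim
        case (elim t)
        \<comment> \<open>On the axis all factors but the \<open>j\<close>-th are values at 0, hence
          1, and the joint characteristic function is itself the \<open>j\<close>-th one. What
          remains after cancelling is \<open>exp (Q t) = 1\<close>.\<close>
        have "(\<Prod>i\<in>UNIV. char_fun_comp M i (axis j (t $ j) $ i)) = (\<Prod>i\<in>UNIV. if i = j then char_fun_comp M j (t $ j) else 1)"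
          by (intro prod.cong) (auto simp: axis_def char_fun_comp_0[OF M(1)])
        then have "char_fun_comp M j (t $ j) = char_fun_comp M j (t $ j) * exp (Q t)"
          using eq[of "axis j (t $ j)"] by (simp add: char_fun_axis Q_def)
        then show ?case using elim by simp
      qed
    qed
    then obtain \<delta> where \<delta>: "\<delta> > 0" "\<And>t. norm t < \<delta> \<Longrightarrow> Q t = 0"
      by (auto simp: eventually_nhds_metric)
    \<comment> \<open>These are the coefficients of \<open>Q\<close>: a monomial involving another
      variable vanishes on the axis, and every other monomial is unchanged.\<close>
    have "(if \<forall>i. i \<noteq> j \<longrightarrow> k i = 0 then a k else 0) = 0"
    proof (rule monomials_independent[OF fin[folded S_def] \<delta>(1)])
      fix t :: "real ^ 'n" assume "norm t < \<delta>"
      have "a k * monom_at k (axis j (t $ j)) = (if \<forall>i. i \<noteq> j \<longrightarrow> k i = 0 then a k else 0) * monom_at k t" for k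
      proof (cases "\<forall>i. i \<noteq> j \<longrightarrow> k i = 0")
        case True
        then have "monom_at k (axis j (t $ j)) = monom_at k t"
          by (intro prod.cong refl) (auto simp: axis_def)
        with True show ?thesis by simp
      next
        case False
        then obtain i where i: "i \<noteq> j" "k i \<noteq> 0" by auto
        then have "monom_at k (axis j (t $ j)) = 0"
          by (intro prod_zero) (auto simp: axis_def intro!: bexI[of _ i])
        with False show ?thesis by (simp only: if_False mult_zero_left mult_zero_right)
      qed
      then have "(\<Sum>k\<in>S. (if \<forall>i. i \<noteq> j \<longrightarrow> k i = 0 then a k else 0) * monom_at k t) = Q t"
        by (simp add: Q_def q_eq)
      then show "(\<Sum>k\<in>S. (if \<forall>i. i \<noteq> j \<longrightarrow> k i = 0 then a k else 0) * monom_at k t) = 0"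
        using \<delta> \<open>norm t < \<delta>\<close> by simp
    qed (use \<open>a k \<noteq> 0\<close> in \<open>simp add: S_def\<close>)
    moreover have "\<forall>i. i \<noteq> j \<longrightarrow> k i = 0" using j by blast
    ultimately show False using \<open>a k \<noteq> 0\<close> by simp
  qed
  \<comment> \<open>The conjugated identity at \<open>t\<close> and the identity at
    \<open>- t\<close> have the same left side and the same product of component functions, so their
    exponential factors agree. The coefficients of \<open>Q\<close> measure the failure of condition
    (ii).\<close>
  define Q where "Q = (\<lambda>t. cnj (mpoly_eval a t) - mpoly_eval a (- t))"
  have "eventually (\<lambda>t. Q t = 0) (nhds 0)"
  proof (rule exp_eq_1_imp_locally_zero)
    show "isCont Q 0" unfolding Q_def
      by (intro continuous_intros isCont_mpoly_eval continuous_within_compose3[OF isCont_mpoly_eval])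
    show "Q 0 = 0" using a0 by (simp add: Q_def mpoly_eval_zero)
    show "eventually (\<lambda>t. exp (Q t) = 1) (nhds 0)"
      using nz
    proof eventually_elim
      case (elim t)
      have "(\<Prod>j\<in>UNIV. char_fun_comp M j ((- t) $ j)) * exp (mpoly_eval a (- t)) =
            (\<Prod>j\<in>UNIV. char_fun_comp M j ((- t) $ j)) * exp (cnj (mpoly_eval a t))"
        using eq[of "-t"] arg_cong[OF eq[of t], of cnj] by (simp add: cnj_char_fun exp_cnj)
      moreover have "(\<Prod>j\<in>UNIV. char_fun_comp M j ((- t) $ j)) \<noteq> 0"
      proof -
        have "char_fun_comp M j ((- t) $ j) = cnj (char_fun_comp M j (t $ j))" for j
          by (simp add: cnj_char_fun)
        then show ?thesis using elim by simp
      qed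
      ultimately show ?case by (simp add: Q_def exp_diff)
    qed
  qed
  then obtain \<delta> where \<delta>: "\<delta> > 0" "\<And>t. norm t < \<delta> \<Longrightarrow> Q t = 0"
    by (auto simp: eventually_nhds_metric)
  show "cnj (a k) = (-1) ^ (\<Sum>j\<in>UNIV. k j) * a k"
  proof (cases "k \<in> S")
    case True
    have "cnj (a k) - (-1) ^ (\<Sum>j\<in>UNIV. k j) * a k = 0"
    proof (rule monomials_independent[OF fin[folded S_def] \<delta>(1) _ True])
      fix t :: "real ^ 'n" assume "norm t < \<delta>"
      have "monom_at k (- t) = (-1) ^ (\<Sum>j\<in>UNIV. k j) * monom_at k t" for k :: "'n \<Rightarrow> nat"
      proof -
        have "monom_at k (- t) = (\<Prod>j\<in>UNIV. (-1) ^ k j * complex_of_real ((t $ j) ^ k j))"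
          by (intro prod.cong refl) (simp add: power_minus[of "complex_of_real _"])
        then show ?thesis by (simp add: prod.distrib power_sum)
      qed
      then have "(\<Sum>k\<in>S. (cnj (a k) - (-1) ^ (\<Sum>j\<in>UNIV. k j) * a k) * monom_at k t) = Q t"
        unfolding Q_def q_eq cnj_sum sum_subtractf[symmetric]
        by (intro sum.cong refl) (simp add: algebra_simps)
      then show "(\<Sum>k\<in>S. (cnj (a k) - (-1) ^ (\<Sum>j\<in>UNIV. k j) * a k) * monom_at k t) = 0"
        using \<delta> \<open>norm t < \<delta>\<close> by simp
    qed
    then show ?thesis by simp
  qed (simp add: S_def)
qed

section \<open>A band-limited density dominating its derivatives\<close>

text \<open>The \<open>k\<close>-th derivative of \<open>(cosh 1 - cos x) / (1 + x\<^sup>2)\<close>, written as a Fourier integral so that it can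
  be bounded uniformly in \<open>k\<close> up to a geometric factor.\<close>

definition kern :: "nat \<Rightarrow> real \<Rightarrow> real" where
  "kern k x = integral {0..1} (\<lambda>t. t ^ k * sinh (1 - t) * cos (t * x + k * pi / 2))"

lemma kern_integrable:
  "(\<lambda>t. t ^ k * sinh (1 - t) * cos (t * x + k * pi / 2)) integrable_on {0..1::real}"
  by (intro integrable_continuous_real continuous_intros)

text \<open>Differentiation under the integral sign. It brings down a factor \<open>t\<close> and
  turns the cosine into minus a sine, which is the cosine shifted by \<open>pi / 2\<close>; the
  phase in \<open>kern\<close> records these shifts.\<close>

lemma kern_deriv: "(kern k has_real_derivative kern (Suc k) x) (at x)"
proof -
  have [simp]: "cos (t * x + real (Suc k) * pi / 2) = - sin (t * x + real k * pi / 2)" for t x :: real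
    by (simp add: distrib_right add_divide_distrib cos_add sin_add algebra_simps)
  have "((\<lambda>x. integral (cbox 0 1) (\<lambda>t. t ^ k * sinh (1 - t) * cos (t * x + k * pi / 2)))
      has_field_derivative integral (cbox 0 1) (\<lambda>t. t ^ Suc k * sinh (1 - t) * cos (t * x + Suc k * pi / 2)))
      (at x within UNIV)"
  proof (rule leibniz_rule_field_derivative[where U = UNIV])
    show "((\<lambda>x. t ^ k * sinh (1 - t) * cos (t * x + real k * pi / 2)) has_real_derivative
        t ^ Suc k * sinh (1 - t) * cos (t * x + real (Suc k) * pi / 2)) (at x within UNIV)" for x t :: real
      by (auto intro!: derivative_eq_intros simp del: of_nat_Suc)
  qed (auto simp: split_beta intro!: integrable_continuous_real continuous_intros)
  then show ?thesis unfolding kern_def by simp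
qed

text \<open>Two integrations by parts. With \<open>V t = t\<^sup>k sinh (1 - t)\<close>, the remainder \<open>R\<close> is \<open>V'' - V\<close>.\<close>

lemma kern_identity:
  fixes k :: nat and x :: real
  defines "R \<equiv> \<lambda>t::real. real (k * (k - 1)) * t ^ (k - 2) * sinh (1 - t) - 2 * real k * t ^ (k - 1) * cosh (1 - t)"
  defines "V' \<equiv> \<lambda>t::real. real k * t ^ (k - 1) * sinh (1 - t) - t ^ k * cosh (1 - t)"
  shows "(1 + x\<^sup>2) * kern k x =
    - cos (x + k * pi / 2) - V' 0 * cos (k * pi / 2) - integral {0..1} (\<lambda>t. R t * cos (t * x + k * pi / 2))"
proof -
  define \<theta> where "\<theta> = real k * pi / 2"
  define V where "V = (\<lambda>t::real. t ^ k * sinh (1 - t))"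
  \<comment> \<open>\<open>G\<close> collects the boundary terms of both integrations by parts; in
    its derivative the terms with \<open>V' t * x * sin\<close> cancel.\<close>
  define G where "G = (\<lambda>t. V t * x * sin (t * x + \<theta>) + V' t * cos (t * x + \<theta>))"
  have dV: "(V has_real_derivative V' t) (at t)" for t
    unfolding V_def V'_def by (auto intro!: derivative_eq_intros)
  have dV': "(V' has_real_derivative R t + V t) (at t)" for t
    unfolding V_def V'_def R_def
    by (auto intro!: derivative_eq_intros) (cases k; auto simp: algebra_simps numeral_2_eq_2)
  have dG: "(G has_real_derivative (1 + x\<^sup>2) * (V t * cos (t * x + \<theta>)) + R t * cos (t * x + \<theta>)) (at t)" for t
    unfolding G_def
    by (auto intro!: derivative_eq_intros dV dV' simp: algebra_simps power2_eq_square)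
  have "((\<lambda>t. (1 + x\<^sup>2) * (V t * cos (t * x + \<theta>)) + R t * cos (t * x + \<theta>)) has_integral G 1 - G 0) {0..1}"
    by (rule fundamental_theorem_of_calculus)
       (auto simp flip: has_real_derivative_iff_has_vector_derivative intro: has_field_derivative_at_within dG)
  moreover have iV: "(\<lambda>t. V t * cos (t * x + \<theta>)) integrable_on {0..1}"
    using kern_integrable[of k x] by (simp add: V_def \<theta>_def)
  moreover have iR: "(\<lambda>t. R t * cos (t * x + \<theta>)) integrable_on {0..1}"
    unfolding R_def by (intro integrable_continuous_real continuous_intros)
  ultimately have "G 1 - G 0 = (1 + x\<^sup>2) * kern k x + integral {0..1} (\<lambda>t. R t * cos (t * x + \<theta>))"
    by (simp add: has_integral_iff Henstock_Kurzweil_Integration.integral_add integrable_on_mult_right kern_def V_def \<theta>_def)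
  moreover have "G 1 = - cos (x + \<theta>)"
    by (simp add: G_def V_def V'_def)
  \<comment> \<open>The sine term drops out at 0 because \<open>V 0 = 0\<close> for
    \<open>k > 0\<close>, while \<open>\<theta> = 0\<close> for \<open>k = 0\<close>.\<close>
  moreover have "G 0 = V' 0 * cos \<theta>"
    by (cases k) (auto simp: G_def V_def \<theta>_def)
  ultimately show ?thesis by (simp add: \<theta>_def)
qed

text \<open>For \<open>k = 0\<close> the remainder in \<open>kern_identity\<close> vanishes and the
  boundary term at 0 contributes \<open>cosh 1\<close>.\<close>

lemma kern_0: "kern 0 x = (cosh 1 - cos x) / (1 + x\<^sup>2)"
proof -
  have "1 + x\<^sup>2 \<noteq> 0" by (metis add_pos_nonneg less_irrefl zero_le_power2 zero_less_one)
  with kern_identity[of x 0] show ?thesis by (simp add: field_simps)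
qed

lemma cosh_1_gt_1: "cosh (1::real) > 1"
  using cosh_real_strict_mono[of 0 1] by simp

text \<open>Each of the three terms in \<open>kern_identity\<close> is at most
  \<open>cosh 1 * 4 ^ k\<close>. The decay in \<open>x\<close> is the same for every
  \<open>k\<close> and matches that of \<open>kern 0\<close>, so \<open>kern 0\<close> will dominate
  all its derivatives.\<close>

lemma kern_bound: "\<bar>kern k x\<bar> \<le> 3 * cosh 1 * 4 ^ k / (1 + x\<^sup>2)"
proof -
  define R where "R = (\<lambda>t::real. real (k * (k - 1)) * t ^ (k - 2) * sinh (1 - t) - 2 * real k * t ^ (k - 1) * cosh (1 - t))"
  define v where "v = real k * 0 ^ (k - 1) * sinh (1 - 0) - 0 ^ k * cosh (1 - 0::real)"
  have c1: "cosh (1::real) > 1" by (rule cosh_1_gt_1)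
  have s1: "0 \<le> sinh (1 - t)" "sinh (1 - t) \<le> cosh 1" "0 \<le> cosh (1 - t)" "cosh (1 - t) \<le> cosh 1"
    if "t \<in> {0..1}" for t :: real
  proof -
    show c: "cosh (1 - t) \<le> cosh 1" using that by (subst cosh_real_nonneg_le_iff) auto
    show "0 \<le> sinh (1 - t)" using that by simp
    show "sinh (1 - t) \<le> cosh 1" using sinh_less_cosh_real[of "1 - t"] c by linarith
  qed auto
  \<comment> \<open>The geometric factor absorbs the growth \<open>k\<^sup>2 + k\<close> of
    \<open>R\<close>. The bound is for \<open>(k + 1)\<^sup>2\<close> because
    \<open>(k + 2)\<^sup>2 \<le> 4 * (k + 1)\<^sup>2\<close> makes the induction immediate.\<close>
  have k4: "real k * real k + 2 * real k + 1 \<le> 4 ^ k"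
  proof (induction k)
    case (Suc k)
    have "real (Suc k) * real (Suc k) + 2 * real (Suc k) + 1 = real k * real k + 4 * real k + 4"
      by (simp add: algebra_simps)
    also have "\<dots> \<le> 4 * (real k * real k + 2 * real k + 1)"
      using zero_le_square[of "real k"] unfolding distrib_left by linarith
    also have "\<dots> \<le> 4 ^ Suc k" using Suc by simp
    finally show ?case .
  qed simp
  have v: "\<bar>v\<bar> \<le> cosh 1 * 4 ^ k"
  proof -
    \<comment> \<open>Since \<open>0 ^ 0 = 1\<close>, \<open>v\<close> is \<open>- cosh 1\<close>
      for \<open>k = 0\<close> and \<open>sinh 1\<close> for \<open>k = 1\<close>; it is 0 for all
      larger \<open>k\<close>.\<close>
    have "\<bar>v\<bar> \<le> cosh 1" 
      using s1[of 0] unfolding v_def by (cases k; cases "k - 1") auto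
    also have "\<dots> \<le> cosh 1 * 4 ^ k" by simp
    finally show ?thesis .
  qed
  have R: "\<bar>R t * cos (t * x + k * pi / 2)\<bar> \<le> cosh 1 * 4 ^ k" if t: "t \<in> {0..1}" for t
  proof -
    have "\<bar>R t * cos (t * x + k * pi / 2)\<bar> \<le> \<bar>R t\<bar> * 1"
      unfolding abs_mult by (intro mult_left_mono) auto
    also have "\<bar>R t\<bar> \<le> \<bar>real (k * (k - 1)) * t ^ (k - 2) * sinh (1 - t)\<bar> + \<bar>2 * real k * t ^ (k - 1) * cosh (1 - t)\<bar>"
      unfolding R_def by (rule abs_triangle_ineq4)
    also have "\<dots> \<le> real (k * (k - 1)) * 1 * cosh 1 + 2 * real k * 1 * cosh 1"
      unfolding abs_mult using t s1[OF t]
      by (intro add_mono mult_mono) (auto simp: power_le_one)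
    also have "\<dots> = (real k * real k + real k) * cosh 1"
      by (cases k) (auto simp: algebra_simps)
    also have "\<dots> \<le> 4 ^ k * cosh 1"
      by (intro mult_right_mono) (use k4 in auto)
    finally show ?thesis by (simp add: mult_ac)
  qed
  have id: "(1 + x\<^sup>2) * kern k x = - cos (x + k * pi / 2) - v * cos (k * pi / 2)
      - integral {0..1} (\<lambda>t. R t * cos (t * x + k * pi / 2))"
    unfolding kern_identity R_def v_def ..
  define K where "K = cosh 1 * (4::real) ^ k"
  have three: "\<bar>(1 + x\<^sup>2) * kern k x\<bar> \<le> c + d + e"
    if "\<bar>cos (x + k * pi / 2)\<bar> \<le> c" "\<bar>v * cos (k * pi / 2)\<bar> \<le> d"
      "\<bar>integral {0..1} (\<lambda>t. R t * cos (t * x + k * pi / 2))\<bar> \<le> e" for c d e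
    using that unfolding id by linarith
  have "\<bar>integral {0..1} (\<lambda>t. R t * cos (t * x + k * pi / 2))\<bar> \<le> cosh 1 * 4 ^ k * (1 - 0)"
    unfolding real_norm_def[symmetric]
    by (rule integral_bound) (use R in \<open>auto simp: R_def intro!: continuous_intros\<close>)
  moreover have "\<bar>v * cos (k * pi / 2)\<bar> \<le> \<bar>v\<bar> * 1"
    unfolding abs_mult by (intro mult_left_mono) auto
  moreover have "\<bar>cos (x + k * pi / 2)\<bar> \<le> cosh 1 * 4 ^ k"
  proof -
    have "\<bar>cos (x + k * pi / 2)\<bar> \<le> 1 * 1" by simp
    also have "\<dots> \<le> cosh 1 * 4 ^ k" using c1 by (intro mult_mono) auto
    finally show ?thesis .
  qed
  ultimately have "\<bar>(1 + x\<^sup>2) * kern k x\<bar> \<le> K + K + K"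
    using v by (intro three) (simp_all add: K_def)
  moreover have "0 < 1 + x\<^sup>2" by (simp add: add_pos_nonneg)
  ultimately show ?thesis by (simp add: K_def abs_mult field_simps)
qed


section \<open>Fourier transforms of derivatives\<close>

text \<open>Integration by parts over the whole line: \<open>f\<close> is the derivative of
  \<open>F x = g x *\<^sub>R iexp (t * x)\<close>, which tends to 0 at both ends because the
  exponential has modulus 1.\<close>

lemma Fourier_transform_deriv:
  fixes g g' :: "real \<Rightarrow> real" and t :: real
  assumes dg: "\<And>x. (g has_real_derivative g' x) (at x)"
    and cont: "\<And>x. isCont g' x"
    and int: "integrable lborel g" "integrable lborel g'"
    and lim: "(g \<longlongrightarrow> 0) at_top" "(g \<longlongrightarrow> 0) at_bot"
  shows "(LINT x|lborel. g' x *\<^sub>R iexp (t * x)) = (- \<i> * t) * (LINT x|lborel. g x *\<^sub>R iexp (t * x))"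
proof -
  have int_exp: "integrable lborel (\<lambda>x. f x *\<^sub>R iexp (t * x))" if "integrable lborel f" for f :: "real \<Rightarrow> real"
    by (rule Bochner_Integration.integrable_bound[OF that]) (use that in auto)
  define F where "F = (\<lambda>x. g x *\<^sub>R iexp (t * x))"
  define f where "f = (\<lambda>x. g' x *\<^sub>R iexp (t * x) + (\<i> * t) * (g x *\<^sub>R iexp (t * x)))"
  have intf: "integrable lborel f"
    unfolding f_def by (intro Bochner_Integration.integrable_add integrable_mult_right int_exp int)
  have lim_exp: "(F \<longlongrightarrow> 0) H" if "(g \<longlongrightarrow> 0) H" for H
  proof (rule tendsto_norm_zero_cancel)
    have "(\<lambda>x. norm (F x)) = (\<lambda>x. \<bar>g x\<bar>)"
      by (simp add: F_def fun_eq_iff)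
    then show "((\<lambda>x. norm (F x)) \<longlongrightarrow> 0) H"
      using tendsto_rabs_zero[OF that] by simp
  qed
  have "(LBINT x=-\<infinity>..\<infinity>. f x) = 0 - 0"
  proof (rule interval_integral_FTC_integrable[where F = F])
    show "(F has_vector_derivative f x) (at x)" for x
    proof -
      have "((\<lambda>x. iexp (t * x)) has_vector_derivative (\<i> * t) * iexp (t * x)) (at x)"
        unfolding of_real_mult mult.assoc[symmetric]
        by (rule has_vector_derivative_real_field) (auto intro!: derivative_eq_intros)
      from has_vector_derivative_scaleR[OF dg this] show ?thesis
        by (simp add: F_def f_def algebra_simps)
    qed
    show "isCont f x" for x
      unfolding f_def using DERIV_isCont[OF dg] cont by (intro continuous_intros) auto
    show "set_integrable lborel (einterval (-\<infinity>) \<infinity>) f"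
      using intf by (simp add: set_integrable_def)
    show "((F \<circ> real_of_ereal) \<longlongrightarrow> 0) (at_right (-\<infinity>))"
      using lim_exp[OF lim(2)] by (simp add: ereal_tendsto_simps)
    show "((F \<circ> real_of_ereal) \<longlongrightarrow> 0) (at_left \<infinity>)"
      using lim_exp[OF lim(1)] by (simp add: ereal_tendsto_simps)
  qed simp
  then have "0 = (LINT x|lborel. f x)"
    by (simp add: interval_lebesgue_integral_def set_lebesgue_integral_def)
  also have "\<dots> = (LINT x|lborel. g' x *\<^sub>R iexp (t * x)) + (\<i> * t) * (LINT x|lborel. g x *\<^sub>R iexp (t * x))"
    unfolding f_def
    by (subst Bochner_Integration.integral_add; (intro integrable_mult_right int_exp int)?)
       (simp only: integral_mult_right_zero)
  finally show ?thesis by (simp only: mult_minus_left eq_neg_iff_add_eq_0)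
qed

text \<open>Supplies the analytic hypotheses of \<open>Fourier_transform_deriv\<close>;
  integrability and the limits come from the majorant in \<open>kern_bound\<close>.\<close>

lemma kern_decay:
  "integrable lborel (kern k)" "(kern k \<longlongrightarrow> 0) at_top" "(kern k \<longlongrightarrow> 0) at_bot" "isCont (kern k) x"
proof -
  show cont: "isCont (kern k) x" for x by (rule DERIV_isCont[OF kern_deriv])
  have [measurable]: "kern k \<in> borel_measurable borel"
    by (intro borel_measurable_continuous_onI) (auto simp: continuous_on_eq_continuous_at cont)
  show "integrable lborel (kern k)"
  proof (rule Bochner_Integration.integrable_bound)
    show "integrable lborel (\<lambda>x::real. 3 * cosh 1 * 4 ^ k * inverse (1 + x\<^sup>2))"
      using integrable_inverse_1_plus_square by (intro integrable_mult_right) (simp add: set_integrable_def)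
  qed (use kern_bound[of k] in \<open>auto simp: divide_inverse intro!: order_trans[OF _ abs_ge_self]\<close>)
  have lim: "((\<lambda>x::real. 3 * cosh 1 * 4 ^ k / (1 + x\<^sup>2)) \<longlongrightarrow> 0) at_top"
            "((\<lambda>x::real. 3 * cosh 1 * 4 ^ k / (1 + x\<^sup>2)) \<longlongrightarrow> 0) at_bot"
    by real_asymp+
  show "(kern k \<longlongrightarrow> 0) at_top" "(kern k \<longlongrightarrow> 0) at_bot"
    by (rule Lim_null_comparison[OF _ lim(1)] Lim_null_comparison[OF _ lim(2)], use kern_bound[of k] in simp)+
qed

text \<open>\<open>\<rho> k\<close> is the quotient of the \<open>k\<close>-th derivative of the density of \<open>\<nu>\<close> by the density itself.\<close>

lemma exists_distribution_bounded_derivatives: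
  obtains C :: real where "C \<ge> 1"
    "\<And>B. B > 0 \<Longrightarrow> \<exists>\<nu> \<rho>. prob_space \<nu> \<and> sets \<nu> = sets borel \<and>
       (\<forall>k. \<rho> k \<in> borel_measurable borel) \<and> (\<forall>k x. \<bar>\<rho> k x\<bar> \<le> C * B ^ k) \<and>
       (\<forall>k t. (LINT x|\<nu>. \<rho> k x *\<^sub>R iexp (t * x)) = (- \<i> * complex_of_real t) ^ k * char \<nu> t)"
proof
  \<comment> \<open>The numerator comes from \<open>kern_bound\<close>, the denominator is the
    minimum of \<open>cosh 1 - cos x\<close>. \<open>C\<close> is fixed before \<open>B\<close>,
    which allows \<open>B\<close> to be chosen later in terms of \<open>C\<close>.\<close>
  define C where "C = 3 * cosh 1 / (cosh 1 - 1 :: real)"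
  have c1: "cosh (1::real) > 1" by (rule cosh_1_gt_1)
  show "C \<ge> 1" unfolding C_def using c1 by (simp add: field_simps)
  fix B :: real assume B: "B > 0"
  \<comment> \<open>Scaling the argument by \<open>e\<close> multiplies the \<open>k\<close>-th
    derivative by \<open>e ^ k\<close>, so the growth factor \<open>4 ^ k\<close> becomes
    \<open>B ^ k\<close>.\<close>
  define e where "e = B / 4"
  have e: "e > 0" using B by (simp add: e_def)
  have pos: "0 < 1 + x\<^sup>2" for x :: real by (simp add: add_pos_nonneg)
  have k0: "kern 0 x > 0" for x
    unfolding kern_0 using c1 cos_le_one[of x] pos[of x] by (intro divide_pos_pos) linarith+
  have kb: "\<bar>kern k x\<bar> \<le> C * 4 ^ k * kern 0 x" for k x
  proof -
    have "\<bar>kern k x\<bar> \<le> C * 4 ^ k * ((cosh 1 - 1) / (1 + x\<^sup>2))"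
      using kern_bound[of k x] c1 by (simp add: C_def)
    also have "\<dots> \<le> C * 4 ^ k * kern 0 x"
      unfolding kern_0 using \<open>C \<ge> 1\<close> pos[of x] by (intro mult_left_mono divide_right_mono) auto
    finally show ?thesis .
  qed
  define Z where "Z = (LINT x|lborel. kern 0 (e * x))"
  have int: "integrable lborel (\<lambda>x. kern k (e * x))" for k
    using lborel_integrable_real_affine[OF kern_decay(1)[of k], of e 0] e by simp
  have contk: "continuous_on UNIV (kern k)" for k
    by (auto simp: continuous_on_eq_continuous_at kern_decay)
  have mk[measurable]: "kern k \<in> borel_measurable borel" for k
    by (intro borel_measurable_continuous_onI contk)
  have Z: "Z > 0"
  proof -
    have "Z \<ge> 0" unfolding Z_def by (intro Bochner_Integration.integral_nonneg) (auto intro: less_imp_le k0)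
    moreover have "Z \<noteq> 0"
    proof
      assume "Z = 0"
      then have "AE x in lborel. kern 0 (e * x) = 0"
        unfolding Z_def by (subst (asm) integral_nonneg_eq_0_iff_AE[OF int]) (auto intro: less_imp_le k0)
      then have "AE x::real in lborel. False"
        by eventually_elim (use k0 in \<open>auto simp: less_le\<close>)
      then show False by (simp add: AE_iff_measurable[OF _ refl])
    qed
    ultimately show ?thesis by simp
  qed
  \<comment> \<open>\<open>g 0\<close> is the normalised density and \<open>g k\<close> its
    \<open>k\<close>-th derivative.\<close>
  define g where "g = (\<lambda>k x. e ^ k * kern k (e * x) / Z)"
  have intg: "integrable lborel (g k)" for k
    unfolding g_def using int[of k] by simp
  have [measurable]: "g k \<in> borel_measurable borel" for k unfolding g_def by measurable
  have g0: "g 0 x > 0" for x using k0 Z by (simp add: g_def)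
  have gb: "\<bar>g k x\<bar> \<le> C * B ^ k * g 0 x" for k x
  proof -
    have "\<bar>g k x\<bar> = e ^ k * \<bar>kern k (e * x)\<bar> / Z"
      using e Z by (simp add: g_def abs_mult)
    also have "\<dots> \<le> e ^ k * (C * 4 ^ k * kern 0 (e * x)) / Z"
      using e Z by (intro divide_right_mono mult_left_mono kb) auto
    also have "\<dots> = C * B ^ k * g 0 x"
      by (simp add: g_def e_def power_divide)
    finally show ?thesis .
  qed
  define \<nu> where "\<nu> = density lborel (\<lambda>x. ennreal (g 0 x))"
  have lint: "(LINT x|\<nu>. f x) = (LINT x|lborel. g 0 x *\<^sub>R f x)" if "f \<in> borel_measurable borel" for f :: "real \<Rightarrow> complex"
    unfolding \<nu>_def using that g0 by (intro integral_density) (auto intro: less_imp_le)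
  have ft: "(LINT x|lborel. g k x *\<^sub>R iexp (t * x)) = (- \<i> * complex_of_real t) ^ k * char \<nu> t" for k t
  proof (induction k)
    case 0
    then show ?case by (simp add: char_def lint)
  next
    case (Suc k)
    have lims: "LIM x at_top. e * x :> at_top" "LIM x at_bot. e * x :> at_bot"
      using e by (auto intro!: filterlim_tendsto_pos_mult_at_top filterlim_tendsto_pos_mult_at_bot tendsto_const filterlim_ident)
    have "(LINT x|lborel. g (Suc k) x *\<^sub>R iexp (t * x)) = (- \<i> * t) * (LINT x|lborel. g k x *\<^sub>R iexp (t * x))"
    proof (rule Fourier_transform_deriv)
      show "(g k has_real_derivative g (Suc k) x) (at x)" for x
        unfolding g_def using Z
        by (auto intro!: derivative_eq_intros DERIV_chain2[OF kern_deriv] simp: field_simps)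
      show "isCont (g (Suc k)) x" for x
        unfolding g_def using Z
        by (intro continuous_intros continuous_within_compose3[OF kern_decay(4)]) auto
      show "(g k \<longlongrightarrow> 0) at_top" "(g k \<longlongrightarrow> 0) at_bot"
        unfolding g_def
        by (intro tendsto_divide_zero tendsto_mult_right_zero filterlim_compose[OF kern_decay(2) lims(1)] filterlim_compose[OF kern_decay(3) lims(2)])+
    qed (rule intg)+
    then show ?case using Suc by simp
  qed
  show "\<exists>\<nu> \<rho>. prob_space \<nu> \<and> sets \<nu> = sets borel \<and>
       (\<forall>k. \<rho> k \<in> borel_measurable borel) \<and> (\<forall>k x. \<bar>\<rho> k x\<bar> \<le> C * B ^ k) \<and>
       (\<forall>k t. (LINT x|\<nu>. \<rho> k x *\<^sub>R iexp (t * x)) = (- \<i> * complex_of_real t) ^ k * char \<nu> t)"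
  proof (intro exI[of _ \<nu>] exI[of _ "\<lambda>k x. g k x / g 0 x"] conjI allI)
    have "(\<integral>\<^sup>+ x. ennreal (g 0 x) \<partial>lborel) = ennreal (LINT x|lborel. g 0 x)"
      by (rule nn_integral_eq_integral[OF intg]) (auto intro: less_imp_le g0)
    also have "(LINT x|lborel. g 0 x) = 1"
      using Z by (simp add: g_def Z_def)
    finally show "prob_space \<nu>"
      by (intro prob_spaceI) (simp add: \<nu>_def emeasure_density)
    show "sets \<nu> = sets borel" by (simp add: \<nu>_def)
    show "\<bar>g k x / g 0 x\<bar> \<le> C * B ^ k" for k x
      using gb[of k x] g0[of x] by (simp add: field_simps)
    have "(LINT x|\<nu>. (g k x / g 0 x) *\<^sub>R iexp (t * x)) = (LINT x|lborel. g k x *\<^sub>R iexp (t * x))" for k t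
      using g0 by (subst lint) (auto simp: less_le)
    then show "(LINT x|\<nu>. (g k x / g 0 x) *\<^sub>R iexp (t * x)) = (- \<i> * complex_of_real t) ^ k * char \<nu> t" for k t
      by (simp only: ft)
  qed measurable
qed

section \<open>Construction of the random vector\<close>

text \<open>The exponential of a sum factors over the coordinates, so Fubini applies; the bounds
  \<open>K j\<close> give integrability of each factor.\<close>

lemma PiM_Fourier:
  fixes h :: "'n::finite \<Rightarrow> real \<Rightarrow> real" and t :: "real ^ 'n"
  assumes \<nu>: "prob_space \<nu>" "sets \<nu> = sets borel"
    and h: "\<And>j. h j \<in> borel_measurable borel" "\<And>j y. \<bar>h j y\<bar> \<le> K j"
  shows "(LINT x|PiM UNIV (\<lambda>_::'n. \<nu>). (\<Prod>j\<in>UNIV. h j (x j)) *\<^sub>R iexp (\<Sum>j\<in>UNIV. t $ j * x j)) =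
    (\<Prod>j\<in>UNIV. LINT y|\<nu>. h j y *\<^sub>R iexp (t $ j * y))"
proof -
  interpret \<nu>: prob_space \<nu> by (rule \<nu>)
  interpret product_sigma_finite "\<lambda>_::'n. \<nu>" ..
  note [measurable_cong] = \<nu>(2)
  note [measurable] = h(1)
  have "(\<Prod>j\<in>UNIV. h j (x j)) *\<^sub>R iexp (\<Sum>j\<in>UNIV. t $ j * x j) = (\<Prod>j\<in>UNIV. h j (x j) *\<^sub>R iexp (t $ j * x j))"
    for x :: "'n \<Rightarrow> real"
    by (simp add: scaleR_conv_of_real sum_distrib_left exp_sum prod.distrib)
  moreover have "integrable \<nu> (\<lambda>y. h j y *\<^sub>R iexp (t $ j * y))" for j
  proof (rule \<nu>.integrable_const_bound[of _ "K j"])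
    show "AE y in \<nu>. norm (h j y *\<^sub>R iexp (t $ j * y)) \<le> K j" using h(2) by simp
  qed measurable
  ultimately show ?thesis
    using product_integral_prod[of UNIV "\<lambda>j y. h j y *\<^sub>R iexp (t $ j * y)"] by simp
qed

text \<open>Multiplying by \<open>q\<close> replaces the monomial \<open>l\<close> by a combination
  of the monomials \<open>l + k\<close>, hence the induction on \<open>m\<close> for arbitrary
  \<open>l\<close>. The functions \<open>\<rho>\<close> enter only in the base case, at the full
  accumulated order, so the factor \<open>C ^ CARD('n)\<close> is paid once and each further power
  of \<open>q\<close> costs only \<open>s\<close>.\<close>

lemma Fourier_multiplier_power:
  fixes b :: "('n::finite \<Rightarrow> nat) \<Rightarrow> real" and \<nu> :: "real measure" and l :: "'n \<Rightarrow> nat"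
  assumes \<nu>: "prob_space \<nu>" "sets \<nu> = sets borel"
    and \<rho>: "\<And>k. \<rho> k \<in> borel_measurable borel" "\<And>k x. \<bar>\<rho> k x\<bar> \<le> C * B ^ k"
      "\<And>k t. (LINT x|\<nu>. \<rho> k x *\<^sub>R iexp (t * x)) = (- \<i> * complex_of_real t) ^ k * char \<nu> t"
    and "finite S"
  defines "q \<equiv> \<lambda>t :: real ^ 'n. \<Sum>k\<in>S. complex_of_real (b k) * (\<Prod>j\<in>UNIV. (- \<i> * complex_of_real (t $ j)) ^ k j)"
  defines "s \<equiv> \<Sum>k\<in>S. \<bar>b k\<bar> * B ^ (\<Sum>j\<in>UNIV. k j)"
  shows "\<exists>f. f \<in> borel_measurable (PiM UNIV (\<lambda>_. \<nu>)) \<and>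
    (\<forall>x. \<bar>f x\<bar> \<le> C ^ CARD('n) * B ^ (\<Sum>j\<in>UNIV. l j) * s ^ m) \<and>
    (\<forall>t. (LINT x|PiM UNIV (\<lambda>_. \<nu>). f x *\<^sub>R iexp (\<Sum>j\<in>UNIV. t $ j * x j)) =
       q t ^ m * (\<Prod>j\<in>UNIV. (- \<i> * complex_of_real (t $ j)) ^ l j) * (\<Prod>j\<in>UNIV. char \<nu> (t $ j)))"
proof (induction m arbitrary: l)
  case 0
  note [measurable_cong] = \<nu>(2)
  note [measurable] = \<rho>(1)
  show ?case
  proof (intro exI[of _ "\<lambda>x. \<Prod>j\<in>UNIV. \<rho> (l j) (x j)"] conjI allI)
    show "\<bar>\<Prod>j\<in>UNIV. \<rho> (l j) (x j)\<bar> \<le> C ^ CARD('n) * B ^ (\<Sum>j\<in>UNIV. l j) * s ^ 0" for x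
    proof -
      have "\<bar>\<Prod>j\<in>UNIV. \<rho> (l j) (x j)\<bar> \<le> (\<Prod>j\<in>UNIV. C * B ^ l j)"
        unfolding abs_prod by (intro prod_mono) (auto intro: \<rho>)
      also have "\<dots> = C ^ CARD('n) * B ^ (\<Sum>j\<in>UNIV. l j)"
        by (simp add: prod.distrib power_sum)
      finally show ?thesis by simp
    qed
    show "(LINT x|PiM UNIV (\<lambda>_. \<nu>). (\<Prod>j\<in>UNIV. \<rho> (l j) (x j)) *\<^sub>R iexp (\<Sum>j\<in>UNIV. t $ j * x j)) =
       q t ^ 0 * (\<Prod>j\<in>UNIV. (- \<i> * complex_of_real (t $ j)) ^ l j) * (\<Prod>j\<in>UNIV. char \<nu> (t $ j))" for t
    proof -
      have "(LINT x|PiM UNIV (\<lambda>_. \<nu>). (\<Prod>j\<in>UNIV. \<rho> (l j) (x j)) *\<^sub>R iexp (\<Sum>j\<in>UNIV. t $ j * x j)) =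
          (\<Prod>j\<in>UNIV. LINT y|\<nu>. \<rho> (l j) y *\<^sub>R iexp (t $ j * y))"
        by (rule PiM_Fourier[OF \<nu> \<rho>(1) \<rho>(2)])
      then show ?thesis by (simp only: \<rho>(3) prod.distrib power_0 mult_1)
    qed
  qed measurable
next
  case (Suc m)
  define P where "P = PiM UNIV (\<lambda>_::'n. \<nu>)"
  interpret P: prob_space P unfolding P_def by (intro prob_space_PiM \<nu>)
  note [measurable_cong] = \<nu>(2)
  \<comment> \<open>The functions are chosen for all \<open>l\<close> simultaneously, since the next
    one combines those at \<open>l + k\<close> for every \<open>k\<close> in
    \<open>S\<close>.\<close>
  have "\<exists>f. \<forall>l. f l \<in> borel_measurable P \<and>
      (\<forall>x. \<bar>f l x\<bar> \<le> C ^ CARD('n) * B ^ (\<Sum>j\<in>UNIV. l j) * s ^ m) \<and>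
      (\<forall>t. (LINT x|P. f l x *\<^sub>R iexp (\<Sum>j\<in>UNIV. t $ j * x j)) =
         q t ^ m * (\<Prod>j\<in>UNIV. (- \<i> * complex_of_real (t $ j)) ^ l j) * (\<Prod>j\<in>UNIV. char \<nu> (t $ j)))"
    unfolding P_def by (intro choice allI Suc.IH)
  then obtain f where f_meas: "\<And>l. f l \<in> borel_measurable P"
    and f_le: "\<And>l x. \<bar>f l x\<bar> \<le> C ^ CARD('n) * B ^ (\<Sum>j\<in>UNIV. l j) * s ^ m"
    and f_ft: "\<And>l t. (LINT x|P. f l x *\<^sub>R iexp (\<Sum>j\<in>UNIV. t $ j * x j)) =
       q t ^ m * (\<Prod>j\<in>UNIV. (- \<i> * complex_of_real (t $ j)) ^ l j) * (\<Prod>j\<in>UNIV. char \<nu> (t $ j))"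
    by blast
  have iexp_meas: "(\<lambda>x. iexp (\<Sum>j\<in>UNIV. t $ j * x j)) \<in> borel_measurable P" for t :: "real ^ 'n"
    unfolding P_def by measurable
  let ?l = "\<lambda>k j. l j + k j"
  define g where "g = (\<lambda>x. \<Sum>k\<in>S. b k * f (?l k) x)"
  show ?case
    unfolding P_def[symmetric]
  proof (intro exI[of _ g] conjI allI)
    show "g \<in> borel_measurable P" unfolding g_def using f_meas by measurable
    show "\<bar>g x\<bar> \<le> C ^ CARD('n) * B ^ (\<Sum>j\<in>UNIV. l j) * s ^ Suc m" for x
    proof -
      have "\<bar>g x\<bar> \<le> (\<Sum>k\<in>S. \<bar>b k * f (?l k) x\<bar>)" unfolding g_def by (rule sum_abs)
      also have "\<dots> \<le> (\<Sum>k\<in>S. \<bar>b k\<bar> * (C ^ CARD('n) * B ^ (\<Sum>j\<in>UNIV. ?l k j) * s ^ m))"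
        unfolding abs_mult by (intro sum_mono mult_left_mono f_le) auto
      also have "\<dots> = C ^ CARD('n) * B ^ (\<Sum>j\<in>UNIV. l j) * s ^ m * (\<Sum>k\<in>S. \<bar>b k\<bar> * B ^ (\<Sum>j\<in>UNIV. k j))"
        unfolding sum_distrib_left by (intro sum.cong refl) (simp add: sum.distrib power_add mult_ac)
      finally show ?thesis by (simp add: s_def mult_ac)
    qed
    show "(LINT x|P. g x *\<^sub>R iexp (\<Sum>j\<in>UNIV. t $ j * x j)) =
      q t ^ Suc m * (\<Prod>j\<in>UNIV. (- \<i> * complex_of_real (t $ j)) ^ l j) * (\<Prod>j\<in>UNIV. char \<nu> (t $ j))" for t
    proof -
      define e where "e = (\<lambda>x. iexp (\<Sum>j\<in>UNIV. t $ j * x j))"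
      have [measurable]: "e \<in> borel_measurable P" unfolding e_def by (rule iexp_meas)
      have ne: "norm (e x) = 1" for x by (simp add: e_def norm_exp_i_times)
      have int: "integrable P (\<lambda>x. f l x *\<^sub>R e x)" for l
      proof (rule P.integrable_const_bound[of _ "C ^ CARD('n) * B ^ (\<Sum>j\<in>UNIV. l j) * s ^ m"])
        show "AE x in P. norm (f l x *\<^sub>R e x) \<le> C ^ CARD('n) * B ^ (\<Sum>j\<in>UNIV. l j) * s ^ m"
          using f_le ne by simp
      qed (use f_meas in measurable)
      have "(LINT x|P. g x *\<^sub>R e x) = (LINT x|P. (\<Sum>k\<in>S. b k *\<^sub>R (f (?l k) x *\<^sub>R e x)))"
        by (simp add: g_def scaleR_sum_left)
      also have "\<dots> = (\<Sum>k\<in>S. b k *\<^sub>R (LINT x|P. f (?l k) x *\<^sub>R e x))"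
        using int by (subst Bochner_Integration.integral_sum) (auto intro!: integrable_scaleR_right simp del: scaleR_scaleR)
      also have "\<dots> = (\<Sum>k\<in>S. b k *\<^sub>R (q t ^ m * (\<Prod>j\<in>UNIV. (- \<i> * complex_of_real (t $ j)) ^ ?l k j) * (\<Prod>j\<in>UNIV. char \<nu> (t $ j))))"
        unfolding e_def f_ft ..
      also have "\<dots> = q t ^ m * (\<Sum>k\<in>S. complex_of_real (b k) * (\<Prod>j\<in>UNIV. (- \<i> * complex_of_real (t $ j)) ^ k j))
          * (\<Prod>j\<in>UNIV. (- \<i> * complex_of_real (t $ j)) ^ l j) * (\<Prod>j\<in>UNIV. char \<nu> (t $ j))"
        unfolding sum_distrib_left sum_distrib_right
        by (intro sum.cong refl) (simp only: power_add prod.distrib scaleR_conv_of_real mult_ac)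
      also have "(\<Sum>k\<in>S. complex_of_real (b k) * (\<Prod>j\<in>UNIV. (- \<i> * complex_of_real (t $ j)) ^ k j)) = q t"
        by (simp only: q_def)
      finally show ?thesis unfolding e_def by (simp only: power_Suc2)
    qed
  qed
qed

section \<open>Sufficiency of the two conditions\<close>

text \<open>Every monomial with nonzero coefficient contains a variable other than the
  \<open>j\<close>-th, which is 0 on this axis. This will leave the marginals unchanged.\<close>

lemma mpoly_eval_axis:
  fixes a :: "('n::finite \<Rightarrow> nat) \<Rightarrow> complex"
  assumes a0: "a (\<lambda>_. 0) = 0" and single: "\<And>k. card {j. k j \<noteq> 0} = 1 \<Longrightarrow> a k = 0"
  shows "mpoly_eval a (axis j r) = 0"
  unfolding mpoly_eval_def
proof (intro sum.neutral ballI)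
  fix k assume k: "k \<in> {k. a k \<noteq> 0}"
  have "\<exists>i. i \<noteq> j \<and> k i \<noteq> 0"
  proof (rule ccontr)
    assume "\<not> ?thesis"
    then have "{j. k j \<noteq> 0} = {j} \<or> k = (\<lambda>_. 0)" by fastforce
    then show False using k a0 single[of k] by auto
  qed
  then obtain i where "i \<noteq> j" "k i \<noteq> 0" by auto
  then have "(\<Prod>i\<in>UNIV. complex_of_real ((axis j r $ i) ^ k i)) = 0"
    by (intro prod_zero) (auto simp: axis_def intro!: bexI[of _ i])
  then show "a k * (\<Prod>i\<in>UNIV. complex_of_real ((axis j r $ i) ^ k i)) = 0" by simp
qed

lemma Q_independence_sufficient:
  fixes a :: "('n::finite \<Rightarrow> nat) \<Rightarrow> complex"
  assumes fin: "finite {k. a k \<noteq> 0}" and a0: "a (\<lambda>_. 0) = 0"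
    and single: "\<And>k. card {j. k j \<noteq> 0} = 1 \<Longrightarrow> a k = 0"
    and par: "\<And>k. cnj (a k) = (-1) ^ (\<Sum>j\<in>UNIV. k j) * a k"
  shows "\<exists>M :: (real ^ 'n) measure. prob_space M \<and> sets M = sets borel \<and>
            (\<forall>t. char_fun_vec M t = (\<Prod>j\<in>UNIV. char_fun_comp M j (t $ j)) * exp (mpoly_eval a t))"
proof -
  define S where "S = {k. a k \<noteq> 0}"
  \<comment> \<open>By the parity condition \<open>\<i> ^ n * a k\<close>, with \<open>n\<close> the
    total degree of \<open>k\<close>, is already real. These are the real coefficients of the
    polynomial in the variables \<open>- \<i> * t $ j\<close>.\<close>
  define b where "b = (\<lambda>k. Re (\<i> ^ (\<Sum>j\<in>UNIV. k j) * a k))"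
  define q where "q = mpoly_eval a"
  have ab: "a k = of_real (b k) * (- \<i>) ^ (\<Sum>j\<in>UNIV. k j)" for k
  proof -
    define n where "n = (\<Sum>j\<in>UNIV. k j)"
    have "cnj (\<i> ^ n * a k) = \<i> ^ n * a k"
    proof -
      have "cnj (\<i> ^ n * a k) = ((- \<i>) ^ n * (-1) ^ n) * a k"
        using par[of k] by (simp add: n_def)
      then show ?thesis by (simp flip: power_mult_distrib)
    qed
    moreover have "of_real (Re z) = z" if "cnj z = z" for z
      using that by (simp add: complex_eq_iff)
    ultimately have "of_real (b k) = \<i> ^ n * a k"
      unfolding b_def n_def by blast
    then have "of_real (b k) * (- \<i>) ^ n = (\<i> * (- \<i>)) ^ n * a k"
      unfolding power_mult_distrib by (simp add: mult_ac)
    then show ?thesis by (simp add: n_def)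
  qed
  have q_eq: "q = (\<lambda>t. \<Sum>k\<in>S. complex_of_real (b k) * (\<Prod>j\<in>UNIV. (- \<i> * complex_of_real (t $ j)) ^ k j))"
    unfolding q_def mpoly_eval_def[abs_def] S_def[symmetric]
    by (intro ext sum.cong refl, subst ab) (simp only: power_mult_distrib prod.distrib power_sum of_real_power mult_ac)
  obtain C :: real where C: "C \<ge> 1" and ex: "\<And>B. B > 0 \<Longrightarrow> \<exists>\<nu> \<rho>. prob_space \<nu> \<and> sets \<nu> = sets borel \<and>
       (\<forall>k. \<rho> k \<in> borel_measurable borel) \<and> (\<forall>k x. \<bar>\<rho> k x\<bar> \<le> C * B ^ k) \<and>
       (\<forall>k t. (LINT x|\<nu>. \<rho> k x *\<^sub>R iexp (t * x)) = (- \<i> * complex_of_real t) ^ k * char \<nu> t)"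
    using exists_distribution_bounded_derivatives by blast
  define D where "D = C ^ CARD('n)"
  have D: "D \<ge> 1" unfolding D_def using C by (rule one_le_power)
  define A where "A = (\<Sum>k\<in>S. \<bar>b k\<bar>) + 1"
  have A: "A > 0" unfolding A_def by (intro add_nonneg_pos sum_nonneg) auto
  \<comment> \<open>As \<open>B \<le> 1\<close> and every monomial in \<open>S\<close> has degree at
    least 1, \<open>s \<le> A * B \<le> ln (1 + 1 / D)\<close>, which yields
    \<open>D * (exp s - 1) \<le> 1\<close>. The summand 1 in \<open>A\<close> avoids division by 0
    when \<open>S\<close> is empty.\<close>
  define B where "B = min 1 (ln (1 + 1 / D) / A)"
  have B: "B > 0" "B \<le> 1" unfolding B_def using A D by (auto intro!: divide_pos_pos ln_gt_zero)
  define s where "s = (\<Sum>k\<in>S. \<bar>b k\<bar> * B ^ (\<Sum>j\<in>UNIV. k j))"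
  have s0: "s \<ge> 0" unfolding s_def using B by (intro sum_nonneg) auto
  have s: "D * (exp s - 1) \<le> 1"
  proof -
    have "s \<le> (\<Sum>k\<in>S. \<bar>b k\<bar> * B)"
      unfolding s_def
    proof (intro sum_mono mult_left_mono)
      fix k assume "k \<in> S"
      with a0 have "k \<noteq> (\<lambda>_. 0)" by (auto simp: S_def)
      then have "(\<Sum>j\<in>UNIV. k j) \<noteq> 0" by (auto simp: fun_eq_iff)
      then have "1 \<le> (\<Sum>j\<in>UNIV. k j)" by linarith
      then have "B ^ (\<Sum>j\<in>UNIV. k j) \<le> B ^ 1" using B by (intro power_decreasing) linarith+
      then show "B ^ (\<Sum>j\<in>UNIV. k j) \<le> B" by simp
    qed auto
    also have "\<dots> \<le> B * A" using B by (simp add: A_def sum_distrib_left[symmetric] sum_distrib_right[symmetric] algebra_simps)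
    also have "\<dots> \<le> ln (1 + 1 / D) / A * A" unfolding B_def using A by (intro mult_right_mono) auto
    finally have "s \<le> ln (1 + 1 / D)" using A by simp
    then have "exp s \<le> 1 + 1 / D" using ln_ge_iff[of "1 + 1 / D" s] D by (simp add: add_pos_nonneg)
    then show ?thesis using D by (simp add: field_simps)
  qed
  from ex[OF B(1)] obtain \<nu> \<rho> where \<nu>: "prob_space \<nu>" "sets \<nu> = sets borel"
    and \<rho>: "\<And>k. \<rho> k \<in> borel_measurable borel" "\<And>k x. \<bar>\<rho> k x\<bar> \<le> C * B ^ k"
      "\<And>k t. (LINT x|\<nu>. \<rho> k x *\<^sub>R iexp (t * x)) = (- \<i> * complex_of_real t) ^ k * char \<nu> t"
    by blast
  define P where "P = PiM UNIV (\<lambda>_::'n. \<nu>)"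
  interpret P: prob_space P unfolding P_def by (intro prob_space_PiM \<nu>)
  note [measurable_cong] = \<nu>(2)
  define \<Phi> where "\<Phi> = (\<lambda>t :: real ^ 'n. \<Prod>j\<in>UNIV. char \<nu> (t $ j))"
  define e where "e = (\<lambda>(t :: real ^ 'n) x. iexp (\<Sum>j\<in>UNIV. t $ j * x j))"
  have e_meas[measurable]: "e t \<in> borel_measurable P" for t unfolding P_def e_def by measurable
  have ne: "norm (e t x) = 1" for t x by (simp add: e_def norm_exp_i_times)
  have "\<exists>f. f \<in> borel_measurable P \<and> (\<forall>x. \<bar>f x\<bar> \<le> D * s ^ m) \<and> (\<forall>t. (LINT x|P. f x *\<^sub>R e t x) = q t ^ m * \<Phi> t)" for m
    using Fourier_multiplier_power[OF \<nu> \<rho> fin[folded S_def], where b = b and l = "\<lambda>_. 0" and m = m]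
    unfolding P_def D_def s_def \<Phi>_def e_def q_eq by simp
  then have "\<exists>f. \<forall>m. f m \<in> borel_measurable P \<and> (\<forall>x. \<bar>f m x\<bar> \<le> D * s ^ m) \<and> (\<forall>t. (LINT x|P. f m x *\<^sub>R e t x) = q t ^ m * \<Phi> t)"
    by (intro choice allI)
  then obtain f0 where f0: "\<And>m. f0 m \<in> borel_measurable P" "\<And>m x. \<bar>f0 m x\<bar> \<le> D * s ^ m"
      "\<And>m t. (LINT x|P. f0 m x *\<^sub>R e t x) = q t ^ m * \<Phi> t"
    by blast
  \<comment> \<open>The multiplier lemma only bounds the zeroth function by \<open>D\<close>.
    Replacing it by the constant 1, which has the same transform, makes the series for
    \<open>F\<close> start exactly with 1.\<close>
  define f where "f = f0(0 := (\<lambda>_. 1))"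
  have f_meas[measurable]: "f m \<in> borel_measurable P" for m using f0(1) by (simp add: f_def)
  have f_le: "\<bar>f m x\<bar> \<le> D * s ^ m" for m x using f0(2)[of m x] D by (simp add: f_def)
  have f_ft: "(LINT x|P. f m x *\<^sub>R e t x) = q t ^ m * \<Phi> t" for m t
  proof (cases "m = 0")
    case True
    have "(LINT x|P. 1 *\<^sub>R e t x) = \<Phi> t"
      using PiM_Fourier[OF \<nu>, of "\<lambda>_ _. 1" "\<lambda>_. 1" t]
      by (simp add: P_def e_def \<Phi>_def char_def)
    with True show ?thesis by (simp add: f_def)
  qed (simp add: f0(3) f_def)
  have sum_D: "(\<lambda>m. D * s ^ m / fact m) sums (D * exp s)"
    using sums_mult[OF exp_converges[of s], of D] by (simp add: field_simps)
  have f_le': "norm (f m x / fact m) \<le> D * s ^ m / fact m" for m x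
    using f_le[of m x] by (simp add: divide_right_mono)
  have summ: "summable (\<lambda>m. f m x / fact m)" for x
    by (rule summable_comparison_test'[OF sums_summable[OF sum_D]]) (rule f_le')
  \<comment> \<open>This mirrors the exponential series: the \<open>m\<close>-th term has transform
    \<open>q t ^ m / fact m * \<Phi> t\<close>.\<close>
  define F where "F = (\<lambda>x. \<Sum>m. f m x / fact m)"
  have F_meas[measurable]: "F \<in> borel_measurable P" unfolding F_def by measurable
  have F_nonneg: "F x \<ge> 0" for x
  proof -
    \<comment> \<open>Without the term \<open>m = 0\<close> the majorant sums to
      \<open>D * (exp s - 1) \<le> 1\<close>, so the tail cannot outweigh the leading 1.\<close>
    have sD: "(\<lambda>m. D * s ^ Suc m / fact (Suc m)) sums (D * exp s - D)"
      using sum_D by (subst sums_Suc_iff) simp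
    have "norm (\<Sum>m. f (Suc m) x / fact (Suc m)) \<le> (\<Sum>m. D * s ^ Suc m / fact (Suc m))"
      by (rule norm_suminf_le[OF _ sums_summable[OF sD]]) (rule f_le')
    also have "\<dots> = D * (exp s - 1)" using sums_unique[OF sD] by (simp add: algebra_simps)
    also have "\<dots> \<le> 1" by (rule s)
    finally have "\<bar>\<Sum>m. f (Suc m) x / fact (Suc m)\<bar> \<le> 1" by simp
    moreover have "F x = 1 + (\<Sum>m. f (Suc m) x / fact (Suc m))"
      unfolding F_def using suminf_split_head[OF summ[of x]] by (simp add: f_def)
    ultimately show ?thesis by linarith
  qed
  have F_ft: "integrable P (\<lambda>x. F x *\<^sub>R e t x) \<and> (LINT x|P. F x *\<^sub>R e t x) = exp (q t) * \<Phi> t" for t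
  proof -
    define h where "h = (\<lambda>m x. (f m x / fact m) *\<^sub>R e t x)"
    have nh: "norm (h m x) \<le> D * s ^ m / fact m" for m x
      using f_le'[of m x] by (simp add: h_def ne)
    have [measurable]: "h m \<in> borel_measurable P" for m unfolding h_def by measurable
    have ih: "integrable P (h m)" for m
      by (rule P.integrable_const_bound[of _ "D * s ^ m / fact m"]) (use nh in auto)
    have h_sum: "summable (\<lambda>m. norm (h m x))" for x
      by (rule summable_comparison_test'[OF sums_summable[OF sum_D]]) (use nh in simp)
    \<comment> \<open>The uniform bounds integrate to themselves over a probability measure, so sum
      and integral may be interchanged.\<close>
    have int_sum: "summable (\<lambda>m. LINT x|P. norm (h m x))"
    proof (rule summable_comparison_test'[OF sums_summable[OF sum_D]])
      fix m
      have "(LINT x|P. norm (h m x)) \<le> (LINT x|P. D * s ^ m / fact m)"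
        by (intro integral_mono integrable_norm ih nh) auto
      then show "norm (LINT x|P. norm (h m x)) \<le> D * s ^ m / fact m"
        by (simp add: P.prob_space)
    qed
    have suminf_h: "(\<Sum>m. h m x) = F x *\<^sub>R e t x" for x
      unfolding h_def F_def by (rule suminf_scaleR_left[OF summ, symmetric])
    have "integrable P (\<lambda>x. \<Sum>m. h m x)"
      by (rule integrable_suminf[OF ih _ int_sum]) (simp add: h_sum)
    moreover have "(LINT x|P. (\<Sum>m. h m x)) = (\<Sum>m. LINT x|P. h m x)"
      by (rule integral_suminf[OF ih _ int_sum]) (simp add: h_sum)
    moreover have "(LINT x|P. h m x) = (q t ^ m /\<^sub>R fact m) * \<Phi> t" for m
    proof -
      have "h m = (\<lambda>x. inverse (fact m) *\<^sub>R (f m x *\<^sub>R e t x))" by (simp add: h_def divide_inverse_commute fun_eq_iff)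
      then have "(LINT x|P. h m x) = inverse (fact m) *\<^sub>R (LINT x|P. f m x *\<^sub>R e t x)"
        by (simp only: integral_scaleR_right)
      then show ?thesis by (simp add: f_ft)
    qed
    moreover have "(\<Sum>m. (q t ^ m /\<^sub>R fact m) * \<Phi> t) = exp (q t) * \<Phi> t"
      by (rule sums_unique[symmetric], rule sums_mult2, rule exp_converges)
    ultimately show ?thesis by (simp add: suminf_h)
  qed
  \<comment> \<open>The density is taken on the function space carrying the product measure, and the
    result is transported to \<open>real ^ 'n\<close>.\<close>
  define M where "M = distr (density P (\<lambda>x. ennreal (F x))) borel (\<lambda>x. \<chi> j. x j)"
  have vec_meas[measurable]: "(\<lambda>x. \<chi> j. x j) \<in> borel_measurable P"
    unfolding P_def
    by (subst borel_measurable_euclidean_space) (auto simp: Basis_vec_def inner_axis)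
  have cf: "char_fun_vec M t = exp (q t) * \<Phi> t" for t
  proof -
    have "char_fun_vec M t = (LINT x|density P (\<lambda>x. ennreal (F x)). e t x)"
      unfolding M_def char_fun_vec_def by (subst integral_distr) (auto simp: e_def)
    also have "\<dots> = (LINT x|P. F x *\<^sub>R e t x)"
      by (rule integral_density) (auto simp: F_nonneg)
    finally show ?thesis using F_ft by simp
  qed
  have char0: "char \<nu> 0 = 1"
    using \<nu> by (simp add: char_def prob_space.prob_space)
  have M_prob: "prob_space M"
  proof -
    \<comment> \<open>The total mass is the transform at 0, which is 1 because
      \<open>q 0 = 0\<close>.\<close>
    have "integrable P (\<lambda>x. complex_of_real (F x))" "(LINT x|P. complex_of_real (F x)) = exp (q 0) * \<Phi> 0"
      using F_ft[of 0] by (auto simp: e_def scaleR_conv_of_real)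
    moreover have "q 0 = 0" "\<Phi> 0 = 1"
      using a0 by (auto simp: q_def mpoly_eval_zero \<Phi>_def char0)
    ultimately have "integrable P F" "complex_of_real (LINT x|P. F x) = 1"
      by (auto simp: complex_of_real_integrable_eq)
    then have "integrable P F" "(LINT x|P. F x) = 1" by auto
    then have "(\<integral>\<^sup>+ x. ennreal (F x) \<partial>P) = 1"
      using F_nonneg by (subst nn_integral_eq_integral) auto
    then have "prob_space (density P (\<lambda>x. ennreal (F x)))"
      by (intro prob_spaceI) (simp add: emeasure_density cong: nn_integral_cong)
    then show ?thesis unfolding M_def by (rule prob_space.prob_space_distr) simp
  qed
  have comp: "char_fun_comp M j r = char \<nu> r" for j r
  proof -
    \<comment> \<open>On an axis \<open>q\<close> vanishes and \<open>\<Phi>\<close> reduces to one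
      factor, so every marginal has the characteristic function of \<open>\<nu>\<close>. Hence
      \<open>\<Phi>\<close> really is the product of the component functions.\<close>
    have "\<Phi> (axis j r) = (\<Prod>i\<in>UNIV. if i = j then char \<nu> r else 1)"
      unfolding \<Phi>_def by (intro prod.cong) (auto simp: axis_def char0)
    then show ?thesis
      using cf[of "axis j r"] mpoly_eval_axis[of a, OF a0 single] by (simp add: char_fun_axis q_def)
  qed
  show ?thesis
    by (intro exI[of _ M] conjI allI M_prob) (simp_all add: cf comp \<Phi>_def q_def, simp add: M_def)
qed

theorem theorem1:
  fixes a :: "('n::finite \<Rightarrow> nat) \<Rightarrow> complex"
  assumes fin: "finite {k. a k \<noteq> 0}"
    and a0: "a (\<lambda>_. 0) = 0"
  shows "(\<exists>M :: (real ^ 'n) measure. prob_space M \<and> sets M = sets borel \<and>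
            (\<forall>t. char_fun_vec M t =
                 (\<Prod>j\<in>UNIV. char_fun_comp M j (t $ j)) * exp (mpoly_eval a t)))
         \<longleftrightarrow>
         ((\<forall>k. card {j. k j \<noteq> 0} = 1 \<longrightarrow> a k = 0) \<and>
          (\<forall>k. (even (\<Sum>j\<in>UNIV. k j) \<longrightarrow> a k \<in> \<real>) \<and>
               (odd (\<Sum>j\<in>UNIV. k j) \<longrightarrow> Re (a k) = 0)))"
proof -
  \<comment> \<open>Rewrites condition (ii) as the conjugation equation used in both
    directions.\<close>
  have parity: "((even n \<longrightarrow> z \<in> \<real>) \<and> (odd n \<longrightarrow> Re z = 0)) \<longleftrightarrow> cnj z = (-1) ^ n * z" for n :: nat and z
    by (cases "even n") (auto simp: complex_is_Real_iff complex_eq_iff)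
  show ?thesis
    unfolding parity
  proof (intro iffI conjI allI impI; (elim exE conjE)?)
    fix M :: "(real ^ 'n) measure" and k :: "'n \<Rightarrow> nat"
    assume "prob_space M" "sets M = sets borel"
      "\<forall>t. char_fun_vec M t = (\<Prod>j\<in>UNIV. char_fun_comp M j (t $ j)) * exp (mpoly_eval a t)"
    note nec = Q_independence_necessary[of a M, OF fin a0 this(1,2) this(3)[rule_format]]
    show "a k = 0" if "card {j. k j \<noteq> 0} = 1" by (rule nec(1)[OF that])
    show "cnj (a k) = (-1) ^ (\<Sum>j\<in>UNIV. k j) * a k" by (rule nec(2))
  qed (rule Q_independence_sufficient[of a, OF fin a0]; blast)
qed

end
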